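(* Consider the initial value problem $u'(t)=f(u(t))$, $t\in[t_0,t_1]$, $u(t_0)=u_0$, with $f:\mathbb{C}^N\to\mathbb{C}^N$ Lipschitz continuous, and the two-level MLSDC iteration for the associated collocation problem with $\Delta t=t_1-t_0$ (see context). If the step size $\Delta t$ is sufficiently small, MLSDC converges linearly to the solution $U_h$ of the (fine-level) collocation problem with a convergence rate in $\mathcal{O}(\Delta t)$, i.e. the MLSDC iterates $U_h^{(k)}$, $k\ge 1$, satisfy $$\|U_h-U_h^{(k)}\|_\infty\le C_9\,\Delta t\,\|U_h-U_h^{(k-1)}\|_\infty,$$ where the constant $C_9$ is independent of $\Delta t$. If, additionally, the solution $u$ of the initial value problem is $(M+1)$-times continuously differentiable, then the error of MLSDC compared to the exact solution $\bar U=(u(\tau_1),\dots,u(\tau_M))^T$ at the collocation nodes is bounded by $$\|\bar U-U_h^{(k)}\|_\infty\le C_{10}\,\Delta t^{k_0+k}\,\|u\|_{k_0+1}+C_{11}\,\Delta t^{M+1}\,\|u\|_{M+1}=\mathcal{O}\big(\Delta t^{\min(k_0+k,\,M+1)}\big),$$ where the constants $C_{10}$ and $C_{11}$ are independent of $\Delta t$ and $k_0$ denotes the approximation order of the initial guess $U_h^{(0)}$.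
   Context: Collocation problem. Besides being Lipschitz continuous, $f$ is assumed to be sufficiently smooth. Let $\Delta t=t_1-t_0$ and let $t_0\le\tau_1<\tau_2<\dots<\tau_M=t_1$ be $M$ quadrature nodes (of a spectral quadrature rule such as Gauss-Radau, scaled from the unit interval to $[t_0,t_1]$). Let $l_j$ be the $j$-th Lagrange polynomial for these nodes and $Q=(q_{m,j})_{1\le m,j\le M}$ with $q_{m,j}=\frac1{\Delta t}\int_{t_0}^{\tau_m}l_j(s)\,ds$. For $U=(u_1,\dots,u_M)^T\in\mathbb{C}^{MN}$ put $F(U)=(f(u_1),\dots,f(u_M))^T$ and $U_0=(u_0,\dots,u_0)^T$. The collocation problem is $C(U):=(I_{MN}-\Delta t(Q\otimes I_N)F)(U)=U_0$. $Q_\Delta\approx Q$ is a lower triangular $M\times M$ matrix coming from a simpler quadrature rule (its entries do not depend on $\Delta t$). Two levels. $\Omega_h$ is the fine level, on which the collocation problem above is posed; its objects carry the index $h$ ($U_h$, $U_{0,h}$, $C_h$, $F_h$, $Q_h$, $Q_{\Delta,h}$). $\Omega_H$ is the coarse level, obtained by using fewer collocation nodes and/or a coarser spatial discretization; its corresponding objects carry the index $H$, and the coarse right-hand side defining $F_H$ is Lipschitz continuous. $M$ is the number of fine-level nodes. $I_h^H$ (restriction, fine to coarse) and $I_H^h$ (interpolation, coarse to fine) are linear transfer operators independent of $\Delta t$, and $U_{0,H}=I_h^HU_{0,h}$. Below, $Q$ and $Q_\Delta$ stand for their Kronecker products with the identity of appropriate size. One MLSDC iteration $U_h^{(k)}\mapsto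 U_h^{(k+1)}$ consists of: 1. $\tau=C_H(I_h^HU_h^{(k)})-I_h^HC_h(U_h^{(k)})=I_h^H(\Delta t\,Q_hF_h(U_h^{(k)}))-\Delta t\,Q_HF_H(I_h^HU_h^{(k)})$. 2. $U_H^{(k+\frac12)}$ solves $U_H^{(k+\frac12)}=U_{0,H}+\tau+\Delta t\,Q_{\Delta,H}F_H(U_H^{(k+\frac12)})+\Delta t\,(Q_H-Q_{\Delta,H})F_H(I_h^HU_h^{(k)})$. 3. $U_h^{(k+\frac12)}=U_h^{(k)}+I_H^h\big(U_H^{(k+\frac12)}-I_h^HU_h^{(k)}\big)$. 4. $U_h^{(k+1)}$ solves $U_h^{(k+1)}=U_{0,h}+\Delta t\,Q_{\Delta,h}F_h(U_h^{(k+1)})+\Delta t\,(Q_h-Q_{\Delta,h})F_h(U_h^{(k+\frac12)})$. Notation. $\|u\|_p:=\|u^{(p)}\|_\infty$ is the maximum norm of the $p$-th derivative of $u$ on the time interval (the derivatives occurring are understood to exist). That $U_h^{(0)}$ has approximation order $k_0$ means $\|\bar U-U_h^{(0)}\|_\infty\le C\,\Delta t^{k_0}\|u\|_{k_0+1}$ with $C$ independent of $\Delta t$. In the second estimate $k$ is fixed and constants may depend on $k$. *)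

theory Defs
  imports "HOL-Analysis.Analysis" "HOL-Library.Landau_Symbols"
begin

text \<open>
  A vector in \<open>\<complex>\<^sup>M\<^sup>N\<close> is indexed by pairs (node, spatial component). The type of node
  indices is a finite linear order with \<open>M\<close> elements.
\<close>

definition maxnorm :: "complex^'a \<Rightarrow> real" where
  "maxnorm v = Max (range (\<lambda>i. cmod (v $ i)))"

definition unit_nodes :: "('m::{finite,linorder} \<Rightarrow> real) \<Rightarrow> bool" where
  "unit_nodes c \<longleftrightarrow> strict_mono c \<and> (\<forall>m. 0 \<le> c m) \<and> c (Max UNIV) = 1"

definition scaled_nodes :: "real \<Rightarrow> real \<Rightarrow> ('m \<Rightarrow> real) \<Rightarrow> 'm \<Rightarrow> real" where
  "scaled_nodes t0 dt c m = t0 + dt * c m"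

definition lagrange_basis :: "('m::finite \<Rightarrow> real) \<Rightarrow> 'm \<Rightarrow> real \<Rightarrow> real" where
  "lagrange_basis \<tau> j s = (\<Prod>i\<in>UNIV - {j}. (s - \<tau> i) / (\<tau> j - \<tau> i))"

definition colloc_matrix :: "real \<Rightarrow> real \<Rightarrow> ('m::finite \<Rightarrow> real) \<Rightarrow> real^'m^'m" where
  "colloc_matrix t0 dt c =
     (let \<tau> = scaled_nodes t0 dt c
      in \<chi> m j. 1 / dt * integral {t0..\<tau> m} (lagrange_basis \<tau> j))"

definition lower_triangular :: "real^('m::{finite,linorder})^('m::{finite,linorder}) \<Rightarrow> bool" where
  "lower_triangular A \<longleftrightarrow> (\<forall>i j. i < j \<longrightarrow> A $ i $ j = 0)"

definition kron_id :: "real^'m^'m \<Rightarrow> complex^('m \<times> 'n::finite)^('m \<times> 'n)" where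
  "kron_id A = (\<chi> a b. complex_of_real (A $ fst a $ fst b) * mat 1 $ snd a $ snd b)"

definition node_value :: "complex^('m::finite \<times> 'n) \<Rightarrow> 'm \<Rightarrow> complex^'n" where
  "node_value U m = (\<chi> i. U $ (m, i))"

definition stack :: "('m::finite \<Rightarrow> complex^'n) \<Rightarrow> complex^('m \<times> 'n)" where
  "stack v = (\<chi> a. v (fst a) $ snd a)"

definition rhs :: "(complex^'n \<Rightarrow> complex^'n) \<Rightarrow> complex^('m::finite \<times> 'n) \<Rightarrow> complex^('m \<times> 'n)" where
  "rhs f U = stack (\<lambda>m. f (node_value U m))"

definition colloc_op ::
  "real \<Rightarrow> real^'m^'m \<Rightarrow> (complex^'n \<Rightarrow> complex^'n) \<Rightarrow> complex^('m \<times> 'n) \<Rightarrow> complex^('m \<times> 'n)" where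
  "colloc_op dt Q f U = U - dt *\<^sub>R (kron_id Q *v rhs f U)"

definition colloc_solution ::
  "(complex^'n \<Rightarrow> complex^'n) \<Rightarrow> ('m::finite \<Rightarrow> real) \<Rightarrow> real \<Rightarrow> complex^'n \<Rightarrow> real
    \<Rightarrow> complex^('m \<times> 'n) \<Rightarrow> bool" where
  "colloc_solution f c t0 u0 dt U \<longleftrightarrow>
     colloc_op dt (colloc_matrix t0 dt c) f U = stack (\<lambda>_. u0)"

text \<open>
  One iteration as a relation between the old iterate \<open>U\<close> and the new iterate \<open>U'\<close>, since two of
  its stages are implicit equations. \<open>R\<close> is the restriction, \<open>P\<close> the interpolation, \<open>UH\<close> and
  \<open>Uhalf\<close> are the half-step iterates on the coarse and the fine level.
\<close>

definition mlsdc_step ::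
  "(complex^'n \<Rightarrow> complex^'n) \<Rightarrow> (complex^'nH \<Rightarrow> complex^'nH)
    \<Rightarrow> ('m::finite \<Rightarrow> real) \<Rightarrow> ('mH::finite \<Rightarrow> real)
    \<Rightarrow> real^'m^'m \<Rightarrow> real^'mH^'mH
    \<Rightarrow> (complex^('m \<times> 'n) \<Rightarrow> complex^('mH \<times> 'nH)) \<Rightarrow> (complex^('mH \<times> 'nH) \<Rightarrow> complex^('m \<times> 'n))
    \<Rightarrow> real \<Rightarrow> complex^'n \<Rightarrow> real \<Rightarrow> complex^('m \<times> 'n) \<Rightarrow> complex^('m \<times> 'n) \<Rightarrow> bool" where
  "mlsdc_step f fH c cH Qd QdH R P t0 u0 dt U U' \<longleftrightarrow>
     (let Q = colloc_matrix t0 dt c; QH = colloc_matrix t0 dt cH;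
          U0 = stack (\<lambda>_. u0); U0H = R U0
      in \<exists>\<tau> UH Uhalf.
           \<tau> = colloc_op dt QH fH (R U) - R (colloc_op dt Q f U) \<and>
           UH = U0H + \<tau> + dt *\<^sub>R (kron_id QdH *v rhs fH UH)
                  + dt *\<^sub>R (kron_id (QH - QdH) *v rhs fH (R U)) \<and>
           Uhalf = U + P (UH - R U) \<and>
           U' = U0 + dt *\<^sub>R (kron_id Qd *v rhs f U')
                  + dt *\<^sub>R (kron_id (Q - Qd) *v rhs f Uhalf))"

definition ivp_solution ::
  "(complex^'n \<Rightarrow> complex^'n) \<Rightarrow> real \<Rightarrow> complex^'n \<Rightarrow> real \<Rightarrow> (real \<Rightarrow> complex^'n) \<Rightarrow> bool" where
  "ivp_solution f t0 u0 t1 u \<longleftrightarrow>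
     u t0 = u0 \<and> (\<forall>t\<in>{t0..t1}. (u has_vector_derivative f (u t)) (at t within {t0..t1}))"

text \<open>Derivatives relative to the time interval \<open>S\<close>, hence one-sided at its endpoints.\<close>

definition nth_deriv ::
  "real set \<Rightarrow> nat \<Rightarrow> (real \<Rightarrow> 'a::real_normed_vector) \<Rightarrow> real \<Rightarrow> 'a" where
  "nth_deriv S p u = ((\<lambda>g t. vector_derivative g (at t within S)) ^^ p) u"

definition cont_diff_on ::
  "nat \<Rightarrow> real set \<Rightarrow> (real \<Rightarrow> 'a::real_normed_vector) \<Rightarrow> bool" where
  "cont_diff_on p S u \<longleftrightarrow>
     (\<forall>j<p. \<forall>t\<in>S. nth_deriv S j u differentiable (at t within S)) \<and>
     continuous_on S (nth_deriv S p u)"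

definition deriv_norm :: "real set \<Rightarrow> nat \<Rightarrow> (real \<Rightarrow> complex^'n) \<Rightarrow> real" where
  "deriv_norm S p u = (SUP t\<in>S. maxnorm (nth_deriv S p u t))"

definition exact_values ::
  "('m::finite \<Rightarrow> real) \<Rightarrow> (real \<Rightarrow> complex^'n) \<Rightarrow> real \<Rightarrow> real \<Rightarrow> complex^('m \<times> 'n)" where
  "exact_values c u t0 dt = stack (\<lambda>m. u (scaled_nodes t0 dt c m))"

text \<open>
  The family \<open>V\<close> of approximations, indexed by the step size \<open>dt \<le> T\<close>, has approximation order
  \<open>k0\<close> with constant \<open>K\<close>.
\<close>

definition approx_order ::
  "('m::finite \<Rightarrow> real) \<Rightarrow> (real \<Rightarrow> complex^'n) \<Rightarrow> real \<Rightarrow> real \<Rightarrow> nat \<Rightarrow> real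
    \<Rightarrow> (real \<Rightarrow> complex^('m \<times> 'n)) \<Rightarrow> bool" where
  "approx_order c u t0 T k0 K V \<longleftrightarrow>
     (\<forall>dt\<in>{0<..T}. maxnorm (exact_values c u t0 dt - V dt)
        \<le> K * dt ^ k0 * deriv_norm {t0..t0 + dt} (k0 + 1) u)"

end

theory Submission
  imports Defs "HOL-Computational_Algebra.Polynomial"
begin

text \<open>
  Every vector \<open>V\<close> satisfies \<open>V = U\<^sub>0 + \<Delta>t Q F(V) + r\<close> for some residual \<open>r\<close>. Subtract the stages
  of an iteration from this equation: if the old iterate has error \<open>e\<close>, the half-step iterate has error
  \<open>O(e + |r|)\<close>, and the final fine sweep sees it only through \<open>\<Delta>t F\<close>, which gains a factor \<open>\<Delta>t\<close>; the
  implicit terms are absorbed for small \<open>\<Delta>t\<close>. So the new error is at most \<open>C (\<Delta>t e + |r|)\<close>. With \<open>V\<close> the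
  collocation solution, \<open>r = 0\<close> and this is the linear rate. With \<open>V\<close> the exact nodal values, \<open>r\<close> is
  the quadrature defect, which vanishes on polynomials of degree at most \<open>M\<close> and hence is of order
  \<open>\<Delta>t\<close> to the power \<open>M + 1\<close> by Taylor expansion at \<open>t\<^sub>0\<close>; iterating the bound gives the second
  estimate without solving the collocation problem.
\<close>

section \<open>Error propagation through one perturbed two-level iteration\<close>

text \<open>Absorbs an implicit term. It serves the coarse solve and the final fine sweep, where the
  unknown error appears on both sides with a factor \<open>dt * L\<close>.\<close>

lemma norm_le_of_half:
  fixes w :: real
  assumes "w \<le> dt * L * w + x" "dt * L \<le> 1 / 2" "0 \<le> w"
  shows "w \<le> 2 * x"
proof -
  have "dt * L * w \<le> 1 / 2 * w"
    using assms(2,3) by (rule mult_right_mono)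
  with assms(1) show ?thesis by linarith
qed

text \<open>Here \<open>a\<close> stands for \<open>Q F\<close>, split into the implicit part
  \<open>d\<close> (from \<open>Qd\<close>) and the explicit part \<open>b\<close> (from
  \<open>Q - Qd\<close>); \<open>dH\<close> is the implicit part on the coarse level. The factor
  \<open>8 * L ^ 3\<close> arises as 2 from the absorption, \<open>L\<close> from \<open>b\<close>
  and \<open>4 * L\<^sup>2\<close> from the half step.\<close>

lemma perturbed_two_level_step:
  fixes R :: "'x::real_normed_vector \<Rightarrow> 'y::real_normed_vector"
  assumes L: "1 \<le> L"
    and lip: "\<And>x y. norm (a x - a y) \<le> L * norm (x - y)" "\<And>x y. norm (b x - b y) \<le> L * norm (x - y)"
      "\<And>x y. norm (d x - d y) \<le> L * norm (x - y)" "\<And>x y. norm (dH x - dH y) \<le> L * norm (x - y)"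
    and R: "linear R" "\<And>x. norm (R x) \<le> L * norm x"
    and P: "\<And>y. norm (P y) \<le> L * norm y" "linear P"
    and split: "\<And>x. a x = d x + b x"
    and dt: "0 < dt" "dt \<le> 1 / (2 * L)"
    and V: "V = U0 + dt *\<^sub>R a V + r"
    and UH: "UH = R U0 + dt *\<^sub>R R (a U) + dt *\<^sub>R (dH UH - dH (R U))"
    and U': "U' = U0 + dt *\<^sub>R d U' + dt *\<^sub>R b (U + P (UH - R U))"
  shows "norm (V - U') \<le> 8 * L ^ 3 * (dt * norm (V - U) + norm r)"
proof -
  define e \<rho> where "e = norm (V - U)" and "\<rho> = norm r"
  have nn: "0 \<le> e" "0 \<le> \<rho>" by (simp_all add: e_def \<rho>_def)
  have dtL: "dt * L \<le> 1 / 2" using dt L by (simp add: field_simps)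
  have dt1: "dt \<le> 1" using dt L by (smt (verit) divide_le_eq_1)
  have mono: "norm (R x) \<le> L * s" "norm (P y) \<le> L * t"
    if "norm x \<le> s" "norm y \<le> t" for x y s t
    using R(2)[of x] P(1)[of y] that L
    by (meson mult_left_mono order_trans zero_le_one)+
  have RVU: "norm (R V - R U) \<le> L * e"
    using R(2)[of "V - U"] by (simp add: linear_diff[OF R(1)] e_def)
  define g where "g = norm (R V - UH)"
  have UHRU: "norm (UH - R U) \<le> norm (R V - R U) + g"
    using norm_triangle_ineq4[of "R V - R U" "R V - UH"] by (simp add: g_def)
  \<comment> \<open>Restricting the equation for \<open>V\<close> makes \<open>R U0\<close> cancel;
    what remains is the fine difference and the residual seen through \<open>R\<close>, and the
    coarse implicit term.\<close>
  have "R V - UH = R (dt *\<^sub>R (a V - a U) + r) - dt *\<^sub>R (dH UH - dH (R U))"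
    by (subst V, subst UH) (simp add: linear_add linear_diff linear_scale R(1) algebra_simps)
  also have "norm \<dots> \<le> L * (dt * (L * e) + \<rho>) + dt * (L * (g + L * e))"
  proof (rule order_trans[OF norm_triangle_ineq4 add_mono])
    have "norm (dt *\<^sub>R (a V - a U)) \<le> dt * (L * e)"
      using lip(1)[of V U] dt by (simp add: e_def)
    then have "norm (dt *\<^sub>R (a V - a U) + r) \<le> dt * (L * e) + \<rho>"
      by (simp add: \<rho>_def norm_triangle_mono)
    then show "norm (R (dt *\<^sub>R (a V - a U) + r)) \<le> L * (dt * (L * e) + \<rho>)"
      by (rule mono(1)) auto
    have "norm (UH - R U) \<le> g + L * e"
      using UHRU RVU by simp
    then have "norm (dH UH - dH (R U)) \<le> L * (g + L * e)"
      using lip(4)[of UH "R U"] L by (meson mult_left_mono order_trans zero_le_one)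
    then show "norm (dt *\<^sub>R (dH UH - dH (R U))) \<le> dt * (L * (g + L * e))"
      using dt by simp
  qed
  finally have "g \<le> dt * L * g + (2 * dt * L ^ 2 * e + L * \<rho>)"
    by (simp add: g_def algebra_simps power2_eq_square)
  from norm_le_of_half[OF this dtL] have g: "g \<le> 2 * (2 * dt * L ^ 2 * e + L * \<rho>)"
    by (simp add: g_def)
  \<comment> \<open>One factor \<open>dt * L\<close> is spent as \<open>1 / 2\<close>. Nothing is
    lost, since \<open>h\<close> below contains \<open>e\<close> without a power of
    \<open>dt\<close> anyway.\<close>
  have "2 * dt * L ^ 2 * e = (dt * L) * (2 * L * e)" by (simp add: power2_eq_square)
  also have "\<dots> \<le> 1 / 2 * (2 * L * e)" using dtL nn L by (intro mult_right_mono) auto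
  finally have g: "g \<le> 2 * L * (e + \<rho>)" using g by (simp add: algebra_simps)
  define h where "h = norm (V - (U + P (UH - R U)))"
  \<comment> \<open>Only the size of the coarse correction enters, not the accuracy of the transfer
    operators; hence this stage gains no power of \<open>dt\<close>.\<close>
  have "norm (UH - R U) \<le> 2 * L * (e + \<rho>) + L * e"
    using UHRU RVU g by simp
  then have "norm (P (UH - R U)) \<le> L * (2 * L * (e + \<rho>) + L * e)"
    by (intro mono(2)) auto
  then have "h \<le> e + L * (2 * L * (e + \<rho>) + L * e)"
    unfolding h_def e_def using norm_triangle_ineq4[of "V - U" "P (UH - R U)"]
    by (simp add: diff_diff_eq)
  also have "\<dots> = e + L\<^sup>2 * (3 * e + 2 * \<rho>)" by (simp add: algebra_simps power2_eq_square)
  also have "\<dots> \<le> 4 * L\<^sup>2 * (e + \<rho>)"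
  proof -
    have "1 * e \<le> L\<^sup>2 * e" using L nn by (intro mult_right_mono one_le_power) auto
    moreover have "0 \<le> L\<^sup>2 * \<rho>" using nn by simp
    ultimately show ?thesis by (simp add: algebra_simps)
  qed
  finally have h: "h \<le> 4 * L\<^sup>2 * (e + \<rho>)" .
  define w where "w = norm (V - U')"
  \<comment> \<open>By \<open>split\<close>, \<open>V\<close> satisfies the sweep equation with
    itself in both arguments. The half-step error \<open>h\<close> enters only through
    \<open>dt *\<^sub>R b\<close>, which is where the power of \<open>dt\<close> is gained; the
    \<open>d\<close> term is absorbed.\<close>
  have "V - U' = dt *\<^sub>R (d V - d U') + dt *\<^sub>R (b V - b (U + P (UH - R U))) + r"
    by (subst V, subst U') (simp add: split algebra_simps)
  also have "norm \<dots> \<le> dt * (L * w) + dt * (L * h) + \<rho>"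
  proof (intro norm_triangle_le add_mono)
    show "norm (dt *\<^sub>R (d V - d U')) \<le> dt * (L * w)"
      using lip(3)[of V U'] dt by (simp add: w_def)
    show "norm (dt *\<^sub>R (b V - b (U + P (UH - R U)))) \<le> dt * (L * h)"
      using lip(2) dt by (simp add: h_def)
  qed (simp add: \<rho>_def)
  finally have "w \<le> dt * L * w + (dt * L * h + \<rho>)" by (simp add: w_def mult.assoc)
  from norm_le_of_half[OF this dtL] have "w \<le> 2 * (dt * L * h + \<rho>)" by (simp add: w_def)
  also have "dt * L * h \<le> dt * L * (4 * L\<^sup>2 * (e + \<rho>))"
    using h dt L by (intro mult_left_mono) auto
  \<comment> \<open>The factor \<open>dt\<close> is kept on \<open>e\<close>, but next traded for
    \<open>1 / 2\<close> on \<rho>, whose total coefficient is of order one in any case.\<close>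
  also have "dt * L * (4 * L\<^sup>2 * (e + \<rho>)) = 4 * L ^ 3 * (dt * e) + dt * L * (4 * L\<^sup>2 * \<rho>)"
    by (simp add: algebra_simps power2_eq_square power3_eq_cube)
  also have "dt * L * (4 * L\<^sup>2 * \<rho>) \<le> 1 / 2 * (4 * L\<^sup>2 * \<rho>)"
    using dtL nn by (intro mult_right_mono) auto
  finally have "w \<le> 8 * L ^ 3 * (dt * e) + (4 * L\<^sup>2 * \<rho> + 2 * \<rho>)"
    by (simp add: algebra_simps)
  also have "4 * L\<^sup>2 * \<rho> + 2 * \<rho> \<le> 8 * L ^ 3 * \<rho>"
  proof -
    have "L\<^sup>2 \<le> L ^ 3" "1 \<le> L ^ 3" using L by (auto intro!: power_increasing one_le_power)
    then have "4 * L\<^sup>2 + 2 \<le> 8 * L ^ 3" by linarith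
    from mult_right_mono[OF this nn(2)] show ?thesis by (simp add: algebra_simps)
  qed
  finally show ?thesis by (simp add: w_def e_def \<rho>_def algebra_simps)
qed

text \<open>The perturbations form a geometric series with ratio at most 1/2, whose sum is at most
  \<open>2 * s\<close>; in the induction this is \<open>q * (2 * s) + s \<le> 2 * s\<close>.\<close>

lemma perturbed_contraction_iterate:
  fixes E :: "nat \<Rightarrow> real"
  assumes step: "\<And>k. E (Suc k) \<le> q * E k + s" and q: "0 \<le> q" "q \<le> 1 / 2" and "0 \<le> s"
  shows "E k \<le> q ^ k * E 0 + 2 * s"
proof (induction k)
  case (Suc k)
  have "q * s \<le> 1 / 2 * s" using q \<open>0 \<le> s\<close> by (intro mult_right_mono)
  moreover have "q * E k \<le> q * (q ^ k * E 0 + 2 * s)" using Suc q by (intro mult_left_mono)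
  ultimately show ?case using step[of k] by (simp add: algebra_simps)
qed (use \<open>0 \<le> s\<close> in simp)

section \<open>Lagrange interpolation and moments of the collocation matrix\<close>

lemma lagrange_basis_eq_poly:
  "lagrange_basis \<tau> j s = poly (\<Prod>i\<in>UNIV - {j}. [:- \<tau> i / (\<tau> j - \<tau> i), 1 / (\<tau> j - \<tau> i):]) s"
  by (simp add: lagrange_basis_def poly_prod diff_divide_distrib)

lemma continuous_on_lagrange_basis: "continuous_on S (lagrange_basis \<tau> j)"
  unfolding lagrange_basis_eq_poly[abs_def] by (intro continuous_intros)

lemma lagrange_basis_at_node:
  fixes \<tau> :: "'m::finite \<Rightarrow> real"
  assumes "inj \<tau>"
  shows "lagrange_basis \<tau> j (\<tau> i) = (if i = j then 1 else 0)"
  using assms by (auto simp: lagrange_basis_def inj_eq intro!: prod.neutral)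

text \<open>Both sides are polynomials in \<open>s\<close> of degree below the number of nodes and
  agree at every node; injectivity makes the nodes distinct, so the polynomials coincide.\<close>

lemma lagrange_interpolation_power:
  fixes \<tau> :: "'m::finite \<Rightarrow> real"
  assumes "inj \<tau>" "n < CARD('m)"
  shows "(\<Sum>j\<in>UNIV. lagrange_basis \<tau> j s * \<tau> j ^ n) = s ^ n"
proof -
  define l where "l j = (\<Prod>i\<in>UNIV - {j}. [:- \<tau> i / (\<tau> j - \<tau> i), 1 / (\<tau> j - \<tau> i):])" for j
  have poly_l: "poly (l j) x = lagrange_basis \<tau> j x" for j x
    by (simp only: l_def lagrange_basis_eq_poly)
  have "degree (l j) < CARD('m)" for j
  proof -
    have "degree (l j) \<le> (\<Sum>i\<in>UNIV - {j}. degree [:- \<tau> i / (\<tau> j - \<tau> i), 1 / (\<tau> j - \<tau> i):])"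
      unfolding l_def using degree_prod_sum_le by (metis (no_types, lifting) comp_def finite sum.cong)
    also have "\<dots> \<le> (\<Sum>i\<in>UNIV - {j}. 1)" by (intro sum_mono) auto
    also have "\<dots> < CARD('m)" by (simp add: card_Diff_singleton)
    finally show ?thesis .
  qed
  then have "degree (\<Sum>j\<in>UNIV. smult (\<tau> j ^ n) (l j)) < CARD('m)"
    by (intro degree_sum_less) (auto intro: le_less_trans[OF degree_smult_le])
  then have "(\<Sum>j\<in>UNIV. smult (\<tau> j ^ n) (l j)) = monom 1 n"
  proof (intro poly_eqI_degree[where A = "range \<tau>"])
    fix x assume "x \<in> range \<tau>"
    then show "poly (\<Sum>j\<in>UNIV. smult (\<tau> j ^ n) (l j)) x = poly (monom 1 n) x"
      using lagrange_basis_at_node[OF assms(1)]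
      by (auto simp: poly_sum poly_monom poly_l if_distrib[of "\<lambda>x. _ * x"] cong: if_cong)
  qed (use assms in \<open>simp_all add: card_image degree_monom_eq\<close>)
  then have "poly (\<Sum>j\<in>UNIV. smult (\<tau> j ^ n) (l j)) s = s ^ n"
    by (simp add: poly_monom)
  then show ?thesis
    by (simp add: poly_sum poly_l mult.commute)
qed

lemma scaled_nodes_0_1: "scaled_nodes 0 1 c = c"
  by (simp add: scaled_nodes_def fun_eq_iff)

text \<open>The substitution \<open>s = t0 + dt * x\<close> carries the basis of the scaled nodes to
  that of \<open>c\<close>, and its Jacobian cancels the factor \<open>1 / dt\<close>. This is why
  constants built from \<open>Q\<close> depend neither on \<open>dt\<close> nor on
  \<open>t0\<close>.\<close>

lemma colloc_matrix_scale:
  assumes "0 < dt"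
  shows "colloc_matrix t0 dt c = colloc_matrix 0 1 c"
proof -
  have "1 / dt * integral {t0..t0 + dt * c m} (lagrange_basis (scaled_nodes t0 dt c) j)
      = integral {0..c m} (lagrange_basis c j)" for m j
  proof -
    let ?l = "lagrange_basis (scaled_nodes t0 dt c) j"
    \<comment> \<open>Each factor of the basis is a quotient of differences, in which
      \<open>t0\<close> and \<open>dt\<close> cancel.\<close>
    have l: "?l (dt * x + t0) = lagrange_basis c j x" for x
    proof -
      have "(dt * x + t0 - scaled_nodes t0 dt c i) / (scaled_nodes t0 dt c j - scaled_nodes t0 dt c i)
          = (dt * (x - c i)) / (dt * (c j - c i))" for i
        by (simp add: scaled_nodes_def algebra_simps)
      then show ?thesis using assms by (simp add: lagrange_basis_def)
    qed
    have "(?l has_integral integral {t0..t0 + dt * c m} ?l) (cbox t0 (t0 + dt * c m))"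
      unfolding interval_cbox
      by (intro integrable_integral integrable_continuous continuous_on_lagrange_basis)
    from has_integral_affinity'[OF this \<open>0 < dt\<close>, of t0]
    have "(lagrange_basis c j has_integral inverse dt * integral {t0..t0 + dt * c m} ?l)
        {0..inverse dt * (dt * c m)}"
      by (simp add: l)
    moreover have "inverse dt * (dt * c m) = c m" using assms by simp
    ultimately show ?thesis by (simp add: integral_unique divide_inverse)
  qed
  then show ?thesis
    by (simp add: colloc_matrix_def scaled_nodes_0_1) (simp add: scaled_nodes_def)
qed

text \<open>Row \<open>m\<close> integrates the interpolant from 0 to \<open>c m\<close>, and
  interpolation reproduces these powers, so the quadrature is exact on them.\<close>

lemma colloc_matrix_moment:
  fixes c :: "'m::finite \<Rightarrow> real"
  assumes "inj c" "0 \<le> c m" "n < CARD('m)"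
  shows "(\<Sum>j\<in>UNIV. colloc_matrix 0 1 c $ m $ j * c j ^ n) = c m ^ Suc n / real (Suc n)"
proof -
  have "(\<Sum>j\<in>UNIV. colloc_matrix 0 1 c $ m $ j * c j ^ n)
      = (\<Sum>j\<in>UNIV. integral {0..c m} (\<lambda>s. lagrange_basis c j s * c j ^ n))"
    by (simp add: colloc_matrix_def scaled_nodes_0_1)
  also have "\<dots> = integral {0..c m} (\<lambda>s. \<Sum>j\<in>UNIV. lagrange_basis c j s * c j ^ n)"
    by (subst integral_sum)
      (auto intro!: integrable_continuous_real continuous_intros continuous_on_lagrange_basis)
  also have "\<dots> = integral {0..c m} (\<lambda>s. s ^ n)"
    by (simp add: lagrange_interpolation_power assms)
  also have "((\<lambda>s. s ^ n) has_integral c m ^ Suc n / real (Suc n) - 0 ^ Suc n / real (Suc n)) {0..c m}"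
    using assms(2)
    by (intro fundamental_theorem_of_calculus)
      (auto intro!: DERIV_cdivide[THEN DERIV_cong] DERIV_pow DERIV_subset[OF DERIV_pow]
        simp flip: has_real_derivative_iff_has_vector_derivative simp del: power_Suc)
  then have "integral {0..c m} (\<lambda>s. s ^ n) = c m ^ Suc n / real (Suc n)"
    by (simp add: integral_unique)
  finally show ?thesis .
qed

section \<open>Taylor remainders and the quadrature defect\<close>

text \<open>The integral form of the remainder is available for vector-valued functions; its kernel
  is bounded by \<open>(x - a) ^ (p - 1)\<close>, dropping the factorial. The derivatives form a
  family \<open>D\<close>, so that the bound also applies to the shifted family, that is to the
  first derivative.\<close>

lemma Taylor_remainder_bound:
  fixes D :: "nat \<Rightarrow> real \<Rightarrow> 'a::banach"
  assumes "0 < p" "a \<le> x"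
    and D: "\<And>i t. i < p \<Longrightarrow> t \<in> {a..x} \<Longrightarrow> (D i has_vector_derivative D (Suc i) t) (at t within {a..x})"
    and B: "\<And>t. t \<in> {a..x} \<Longrightarrow> norm (D p t) \<le> B"
  shows "norm (D 0 x - (\<Sum>i<p. ((x - a) ^ i / fact i) *\<^sub>R D i a)) \<le> B * (x - a) ^ p"
proof -
  have B0: "0 \<le> B" using B[of a] assms(2) by (meson atLeastAtMost_iff norm_ge_zero order_refl order_trans)
  have "((\<lambda>t. ((x - t) ^ (p - 1) / fact (p - 1)) *\<^sub>R D p t) has_integral
      D 0 x - (\<Sum>i<p. ((x - a) ^ i / fact i) *\<^sub>R D i a)) (cbox a x)"
    using Taylor_has_integral[of p D "D 0" a x] assms by simp
  then have "norm (D 0 x - (\<Sum>i<p. ((x - a) ^ i / fact i) *\<^sub>R D i a))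
      \<le> ((x - a) ^ (p - 1) * B) * Henstock_Kurzweil_Integration.content (cbox a x)"
  proof (rule has_integral_bound[rotated])
    show "norm (((x - t) ^ (p - 1) / fact (p - 1)) *\<^sub>R D p t) \<le> (x - a) ^ (p - 1) * B"
      if "t \<in> cbox a x" for t
    proof -
      have "(x - t) ^ (p - 1) / fact (p - 1) \<le> (x - a) ^ (p - 1) / 1"
        using that by (intro frac_le power_mono) (auto simp: fact_ge_1)
      then have "(x - t) ^ (p - 1) / fact (p - 1) * norm (D p t) \<le> (x - a) ^ (p - 1) * B"
        using that B[of t] assms(2) by (intro mult_mono) auto
      then show ?thesis using that by simp
    qed
  qed (use B0 assms in simp)
  \<comment> \<open>The interval length supplies the missing power; the case split removes the
    truncated \<open>p - 1\<close>.\<close>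
  also have "\<dots> = B * (x - a) ^ p"
    using assms by (cases p) (simp_all add: algebra_simps)
  finally show ?thesis .
qed

text \<open>Expand \<open>D 0\<close> at \<open>t0\<close> to degree \<open>CARD('m)\<close> and
  \<open>D 1\<close> to one degree less. By \<open>colloc_matrix_moment\<close> the Taylor
  polynomials satisfy the quadrature formula exactly, so only the remainders survive.\<close>

lemma quadrature_residual_bound:
  fixes c :: "'m::finite \<Rightarrow> real" and D :: "nat \<Rightarrow> real \<Rightarrow> 'a::banach"
  assumes c: "inj c" "\<And>j. c j \<in> {0..1}" and dt: "0 < dt"
    and D: "\<And>i t. i \<le> CARD('m) \<Longrightarrow> t \<in> {t0..t0 + dt} \<Longrightarrow>
      (D i has_vector_derivative D (Suc i) t) (at t within {t0..t0 + dt})"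
    and B: "\<And>t. t \<in> {t0..t0 + dt} \<Longrightarrow> norm (D (Suc CARD('m)) t) \<le> B"
  defines "Q \<equiv> colloc_matrix 0 1 c"
  shows "norm (D 0 (t0 + dt * c m) - D 0 t0 - dt *\<^sub>R (\<Sum>j\<in>UNIV. Q $ m $ j *\<^sub>R D 1 (t0 + dt * c j)))
    \<le> (1 + (\<Sum>j\<in>UNIV. \<bar>Q $ m $ j\<bar>)) * B * dt ^ (CARD('m) + 1)"
proof -
  let ?M = "CARD('m)"
  have B0: "0 \<le> B" using B[of t0] dt by (meson atLeastAtMost_iff less_eq_real_def less_add_same_cancel1 norm_ge_zero order_trans)
  \<comment> \<open>These are the remainders of \<open>D 0\<close> and \<open>D 1\<close>. The
    second expansion is one term shorter; the lost power returns with the \<open>dt\<close> in front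
    of the quadrature sum.\<close>
  define g where "g = D 0 (t0 + dt * c m) - (\<Sum>i<Suc ?M. ((dt * c m) ^ i / fact i) *\<^sub>R D i t0)"
  define h where "h j = D 1 (t0 + dt * c j) - (\<Sum>i<?M. ((dt * c j) ^ i / fact i) *\<^sub>R D (Suc i) t0)" for j
  have cj: "0 \<le> dt * c j" "dt * c j \<le> dt" for j
    using c(2)[of j] dt by (auto simp: mult_left_le)
  have sub: "{t0..t0 + dt * c j} \<subseteq> {t0..t0 + dt}" for j using cj[of j] by auto
  have "norm g \<le> B * (dt * c m) ^ Suc ?M"
    using Taylor_remainder_bound[of "Suc ?M" t0 "t0 + dt * c m" D B]
      cj[of m] sub[of m] B has_vector_derivative_within_subset[OF D sub]
    by (simp add: g_def subset_iff del: sum.lessThan_Suc power_Suc)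
  also have "\<dots> \<le> B * dt ^ Suc ?M"
    using cj B0 by (intro mult_left_mono power_mono) auto
  finally have g: "norm g \<le> B * dt ^ Suc ?M" .
  have h: "norm (h j) \<le> B * dt ^ ?M" for j
  proof -
    have "norm (h j) \<le> B * (dt * c j) ^ ?M"
      using Taylor_remainder_bound[of ?M t0 "t0 + dt * c j" "\<lambda>i. D (Suc i)" B]
        cj[of j] sub[of j] B has_vector_derivative_within_subset[OF D sub]
      by (simp add: h_def subset_iff)
    also have "\<dots> \<le> B * dt ^ ?M"
      using cj B0 by (intro mult_left_mono power_mono) auto
    finally show ?thesis .
  qed
  \<comment> \<open>Summing over the nodes first exposes the moments of row
    \<open>m\<close>.\<close>
  have "dt *\<^sub>R (\<Sum>j\<in>UNIV. Q $ m $ j *\<^sub>R (\<Sum>i<?M. ((dt * c j) ^ i / fact i) *\<^sub>R D (Suc i) t0))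
      = (\<Sum>i<?M. \<Sum>j\<in>UNIV. (dt * (Q $ m $ j * ((dt * c j) ^ i / fact i))) *\<^sub>R D (Suc i) t0)"
    by (simp add: scaleR_sum_right sum.swap[of _ _ UNIV])
  also have "\<dots> = (\<Sum>i<?M. (dt ^ Suc i / fact i * (\<Sum>j\<in>UNIV. Q $ m $ j * c j ^ i)) *\<^sub>R D (Suc i) t0)"
    by (simp add: scaleR_sum_left sum_distrib_left power_mult_distrib mult_ac)
  \<comment> \<open>The moment raises degree \<open>i\<close> to \<open>Suc i\<close> and divides by
    \<open>Suc i\<close>, which turns the Taylor polynomial of \<open>D 1\<close> into that of
    \<open>D 0\<close> without its constant term.\<close>
  also have "\<dots> = (\<Sum>i<?M. ((dt * c m) ^ Suc i / fact (Suc i)) *\<^sub>R D (Suc i) t0)"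
  proof (intro sum.cong refl arg_cong2[where f = scaleR])
    fix i assume "i \<in> {..<?M}"
    then have "(\<Sum>j\<in>UNIV. Q $ m $ j * c j ^ i) = c m ^ Suc i / real (Suc i)"
      unfolding Q_def using c(2)[of m] by (intro colloc_matrix_moment c(1)) auto
    then show "dt ^ Suc i / fact i * (\<Sum>j\<in>UNIV. Q $ m $ j * c j ^ i)
        = (dt * c m) ^ Suc i / fact (Suc i)"
      by (simp only: power_mult_distrib fact_Suc) simp
  qed
  \<comment> \<open>Shifting the index splits off \<open>D 0 t0\<close>, the term of index 0; the
    other polynomial terms cancel.\<close>
  finally have "D 0 (t0 + dt * c m) - D 0 t0 - dt *\<^sub>R (\<Sum>j\<in>UNIV. Q $ m $ j *\<^sub>R D 1 (t0 + dt * c j))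
      = g - dt *\<^sub>R (\<Sum>j\<in>UNIV. Q $ m $ j *\<^sub>R h j)"
    unfolding g_def h_def
    by (simp add: sum.lessThan_Suc_shift scaleR_diff_right sum_subtractf del: sum.lessThan_Suc power_Suc fact_Suc)
  also have "norm \<dots> \<le> B * dt ^ Suc ?M + dt * (\<Sum>j\<in>UNIV. \<bar>Q $ m $ j\<bar> * (B * dt ^ ?M))"
  proof (rule order_trans[OF norm_triangle_ineq4 add_mono[OF g]])
    have "norm (\<Sum>j\<in>UNIV. Q $ m $ j *\<^sub>R h j) \<le> (\<Sum>j\<in>UNIV. \<bar>Q $ m $ j\<bar> * (B * dt ^ ?M))"
      by (intro sum_norm_le) (simp add: h mult_left_mono)
    then show "norm (dt *\<^sub>R (\<Sum>j\<in>UNIV. Q $ m $ j *\<^sub>R h j)) \<le> dt * (\<Sum>j\<in>UNIV. \<bar>Q $ m $ j\<bar> * (B * dt ^ ?M))"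
      using dt by simp
  qed
  also have "\<dots> = (1 + (\<Sum>j\<in>UNIV. \<bar>Q $ m $ j\<bar>)) * B * dt ^ (?M + 1)"
    by (simp add: sum_distrib_left sum_distrib_right distrib_left mult_ac)
  finally show ?thesis .
qed

section \<open>Maximum norm, stacked vectors and Kronecker products\<close>

lemma maxnorm_ge_component: "cmod (v $ i) \<le> maxnorm v"
  by (simp add: maxnorm_def)

lemma maxnorm_nonneg: "0 \<le> maxnorm v"
  using maxnorm_ge_component[of v undefined] norm_ge_zero order_trans by blast

lemma maxnorm_le_norm: "maxnorm v \<le> norm v"
  by (simp add: maxnorm_def Finite_Cartesian_Product.norm_nth_le)

text \<open>The error analysis runs in the Euclidean norm; together with
  \<open>maxnorm_le_norm\<close> this converts the results at the cost of the dimension.\<close>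

lemma norm_le_maxnorm:
  fixes v :: "complex^'a"
  shows "norm v \<le> real CARD('a) * maxnorm v"
proof -
  have "norm v \<le> (\<Sum>i\<in>UNIV. cmod (v $ i))"
    by (simp add: norm_vec_def L2_set_le_sum)
  also have "\<dots> \<le> (\<Sum>i\<in>(UNIV :: 'a set). maxnorm v)"
    by (intro sum_mono maxnorm_ge_component)
  finally show ?thesis by simp
qed

lemma maxnorm_diff_le: "\<bar>maxnorm v - maxnorm w\<bar> \<le> norm (v - w)"
proof -
  have "maxnorm a \<le> norm (a - b) + maxnorm b" for a b :: "complex^'a"
  proof -
    have "cmod (a $ i) \<le> norm (a - b) + maxnorm b" for i
    proof -
      have "cmod (a $ i) \<le> cmod ((a - b) $ i) + cmod (b $ i)"
        using norm_triangle_ineq[of "(a - b) $ i" "b $ i"] by simp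
      then show ?thesis
        using Finite_Cartesian_Product.norm_nth_le[of "a - b" i] maxnorm_ge_component[of b i] by linarith
    qed
    then show ?thesis by (simp add: maxnorm_def)
  qed
  from this[of v w] this[of w v] show ?thesis by (simp add: norm_minus_commute)
qed

text \<open>Ensures that the supremum in \<open>deriv_norm\<close> is over a bounded set when the
  derivative is continuous on a compact interval.\<close>

lemma continuous_on_maxnorm: "continuous_on S maxnorm"
  unfolding continuous_on_iff dist_norm real_norm_def
  using maxnorm_diff_le by (meson le_less_trans)

lemma norm_stack:
  fixes v :: "'m::finite \<Rightarrow> complex^'n"
  shows "norm (stack v) = L2_set (\<lambda>m. norm (v m)) UNIV"
  by (simp add: stack_def norm_vec_def L2_set_def sum_nonneg sum.cartesian_product case_prod_unfold)

lemma stack_node_value: "stack (node_value U) = U"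
  by (simp add: stack_def node_value_def vec_eq_iff)

text \<open>\<open>f\<close> acts node by node, and the squared Euclidean norm of a stacked vector
  is the sum of the squared node norms, so the constant of \<open>f\<close> carries over
  unchanged.\<close>

lemma rhs_lipschitz:
  fixes U V :: "complex^('m::finite \<times> 'n::finite)"
  assumes "L-lipschitz_on UNIV f"
  shows "norm (rhs f U - rhs f V) \<le> L * norm (U - V)"
proof -
  have L: "0 \<le> L" using assms lipschitz_on_nonneg by blast
  have "rhs f U - rhs f V = stack (\<lambda>m. f (node_value U m) - f (node_value V m))"
    by (simp add: rhs_def stack_def vec_eq_iff)
  then have "norm (rhs f U - rhs f V) = L2_set (\<lambda>m. norm (f (node_value U m) - f (node_value V m))) UNIV"
    by (simp add: norm_stack)
  also have "\<dots> \<le> L2_set (\<lambda>m. L * norm (node_value (U - V) m)) UNIV"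
  proof (rule L2_set_mono)
    fix m
    have "node_value (U - V) m = node_value U m - node_value V m"
      by (simp add: node_value_def vec_eq_iff)
    then show "norm (f (node_value U m) - f (node_value V m)) \<le> L * norm (node_value (U - V) m)"
      using lipschitz_onD[OF assms, of "node_value U m" "node_value V m"] by (simp add: dist_norm)
  qed simp
  also have "\<dots> = L * norm (stack (node_value (U - V)))"
    by (simp add: norm_stack L2_set_right_distrib L)
  finally show ?thesis by (simp add: stack_node_value)
qed

lemma kron_rhs_lipschitz:
  fixes A :: "real^'m^'m" and f :: "complex^'n \<Rightarrow> complex^'n"
  assumes "\<exists>L. L-lipschitz_on UNIV f"
  shows "\<exists>L. \<forall>U V. norm (kron_id A *v rhs f U - kron_id A *v rhs f V) \<le> L * norm (U - V)"
proof -
  obtain L where L: "L-lipschitz_on UNIV f" using assms by blast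
  obtain K where K: "0 \<le> K" "\<And>x. norm ((kron_id A :: complex^('m \<times> 'n)^('m \<times> 'n)) *v x) \<le> norm x * K"
    using bounded_linear.nonneg_bounded[OF matrix_vector_mul_bounded_linear] by blast
  have "norm (kron_id A *v rhs f U - kron_id A *v rhs f V) \<le> (L * K) * norm (U - V)" for U V
    using K(2)[of "rhs f U - rhs f V"] mult_right_mono[OF rhs_lipschitz[OF L, of U V] K(1)]
    by (simp add: matrix_vector_mult_diff_distrib mult_ac)
  then show ?thesis by blast
qed

lemma kron_id_diff: "kron_id (A - B) = kron_id A - kron_id B"
  by (simp add: kron_id_def vec_eq_iff algebra_simps)

text \<open>The identity factor keeps a single spatial component of the inner sum, which leaves one
  quadrature rule per node.\<close>

lemma kron_id_stack:
  fixes v :: "'m::finite \<Rightarrow> complex^'n"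
  shows "kron_id A *v stack v = stack (\<lambda>m. \<Sum>j\<in>UNIV. A $ m $ j *\<^sub>R v j)"
proof -
  have "(\<Sum>b\<in>UNIV. (complex_of_real (A $ m $ fst b) * mat 1 $ i $ snd b) * v (fst b) $ snd b)
      = (\<Sum>j\<in>UNIV. A $ m $ j *\<^sub>R v j $ i)" for m and i :: 'n
  proof -
    have "(\<Sum>b\<in>UNIV. (complex_of_real (A $ m $ fst b) * mat 1 $ i $ snd b) * v (fst b) $ snd b)
      = (\<Sum>j\<in>UNIV. \<Sum>l\<in>UNIV. (complex_of_real (A $ m $ j) * mat 1 $ i $ l) * v j $ l)"
      by (simp add: sum.cartesian_product case_prod_unfold)
    also have "\<dots> = (\<Sum>j\<in>UNIV. A $ m $ j *\<^sub>R v j $ i)"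
      by (simp add: mat_def if_distrib if_distribR scaleR_conv_of_real cong: if_cong)
    finally show ?thesis .
  qed
  then show ?thesis
    by (simp add: kron_id_def stack_def matrix_vector_mult_def vec_eq_iff)
qed

text \<open>Boundedness of the transfer operators is obtained from real linearity; scaling by a real
  number is a special case of complex scaling.\<close>

lemma complex_linear_imp_linear:
  fixes T :: "complex^'a \<Rightarrow> complex^'b"
  assumes "Vector_Spaces.linear (*s) (*s) T"
  shows "linear T"
proof (rule linearI)
  fix x y and r :: real
  show "T (x + y) = T x + T y" using assms by (simp add: Vector_Spaces.linear_iff)
  have "r *\<^sub>R x = complex_of_real r *s x" "r *\<^sub>R T x = complex_of_real r *s T x"
    by (simp_all add: vec_eq_iff) (simp_all add: scaleR_conv_of_real)
  then show "T (r *\<^sub>R x) = r *\<^sub>R T x" using assms by (simp add: Vector_Spaces.linear_iff)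
qed

section \<open>Error of the MLSDC iteration\<close>

text \<open>An instance of \<open>perturbed_two_level_step\<close>. After rescaling, all matrices
  are fixed, so \<open>C\<close> and \<delta> are chosen before \<open>dt\<close>, \<open>t0\<close>
  and the vectors.\<close>

lemma mlsdc_step_error:
  fixes f :: "complex^'n \<Rightarrow> complex^'n" and fH :: "complex^'nH \<Rightarrow> complex^'nH"
    and c :: "'m::finite \<Rightarrow> real" and cH :: "'mH::finite \<Rightarrow> real"
  assumes lip: "\<exists>L. L-lipschitz_on UNIV f" "\<exists>L. L-lipschitz_on UNIV fH"
    and lin: "linear R" "linear P"
  shows "\<exists>C \<delta>. 0 < C \<and> 0 < \<delta> \<and> (\<forall>dt t0 u0 V r U U'. 0 < dt \<longrightarrow> dt \<le> \<delta> \<longrightarrow>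
    V = stack (\<lambda>_. u0) + dt *\<^sub>R (kron_id (colloc_matrix 0 1 c) *v rhs f V) + r \<longrightarrow>
    mlsdc_step f fH c cH Qd QdH R P t0 u0 dt U U' \<longrightarrow>
    norm (V - U') \<le> C * (dt * norm (V - U) + norm r))"
proof -
  define Q where "Q = colloc_matrix 0 1 c"
  obtain La where La: "\<And>U V. norm (kron_id Q *v rhs f U - kron_id Q *v rhs f V) \<le> La * norm (U - V)"
    using kron_rhs_lipschitz[OF lip(1)] by blast
  obtain Lb where Lb: "\<And>U V. norm (kron_id (Q - Qd) *v rhs f U - kron_id (Q - Qd) *v rhs f V) \<le> Lb * norm (U - V)"
    using kron_rhs_lipschitz[OF lip(1)] by blast
  obtain Ld where Ld: "\<And>U V. norm (kron_id Qd *v rhs f U - kron_id Qd *v rhs f V) \<le> Ld * norm (U - V)"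
    using kron_rhs_lipschitz[OF lip(1)] by blast
  obtain LH where LH: "\<And>U V. norm (kron_id QdH *v rhs fH U - kron_id QdH *v rhs fH V) \<le> LH * norm (U - V)"
    using kron_rhs_lipschitz[OF lip(2)] by blast
  obtain LR where LR: "\<And>x. norm (R x) \<le> LR * norm x"
    using linear_bounded[OF lin(1)] by blast
  obtain LP where LP: "\<And>x. norm (P x) \<le> LP * norm x"
    using linear_bounded[OF lin(2)] by blast
  \<comment> \<open>One constant dominates all bounds; including 1 makes the powers of
    \<open>L\<close> increasing.\<close>
  define L where "L = Max {1, La, Lb, Ld, LH, LR, LP}"
  have le: "1 \<le> L" "La \<le> L" "Lb \<le> L" "Ld \<le> L" "LH \<le> L" "LR \<le> L" "LP \<le> L"
    unfolding L_def by (intro Max_ge; simp)+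
  have "norm (V - U') \<le> 8 * L ^ 3 * (dt * norm (V - U) + norm r)"
    if dt: "0 < dt" "dt \<le> 1 / (2 * L)"
      and V: "V = stack (\<lambda>_. u0) + dt *\<^sub>R (kron_id Q *v rhs f V) + r"
      and step: "mlsdc_step f fH c cH Qd QdH R P t0 u0 dt U U'" for dt t0 u0 V r U U'
  proof -
    define QH where "QH = colloc_matrix 0 1 cH"
    obtain UH where
      UH: "UH = R (stack (\<lambda>_. u0)) + (colloc_op dt QH fH (R U) - R (colloc_op dt Q f U))
          + dt *\<^sub>R (kron_id QdH *v rhs fH UH) + dt *\<^sub>R (kron_id (QH - QdH) *v rhs fH (R U))"
      and U': "U' = stack (\<lambda>_. u0) + dt *\<^sub>R (kron_id Qd *v rhs f U')
          + dt *\<^sub>R (kron_id (Q - Qd) *v rhs f (U + P (UH - R U)))"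
      using step dt
      unfolding mlsdc_step_def Let_def colloc_matrix_scale[OF dt(1)] Q_def QH_def by blast
    \<comment> \<open>The \<tau> correction cancels \<open>R U\<close> and every occurrence of
      \<open>QH\<close>: the restricted fine quadrature takes the place of the coarse one.\<close>
    have UH': "UH = R (stack (\<lambda>_. u0)) + dt *\<^sub>R R (kron_id Q *v rhs f U)
        + dt *\<^sub>R (kron_id QdH *v rhs fH UH - kron_id QdH *v rhs fH (R U))"
      by (subst UH) (simp add: colloc_op_def kron_id_diff linear_diff linear_scale lin
          matrix_vector_mult_diff_rdistrib algebra_simps)
    show ?thesis
    proof (rule perturbed_two_level_step[where L = L and a = "\<lambda>U. kron_id Q *v rhs f U"
          and d = "\<lambda>U. kron_id Qd *v rhs f U" and b = "\<lambda>U. kron_id (Q - Qd) *v rhs f U"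
          and dH = "\<lambda>U. kron_id QdH *v rhs fH U" and R = R and P = P,
          OF le(1) _ _ _ _ lin(1) _ _ lin(2) _ dt V UH' U'])
      show "kron_id Q *v rhs f U = kron_id Qd *v rhs f U + kron_id (Q - Qd) *v rhs f U" for U
        by (simp add: kron_id_diff matrix_vector_mult_diff_rdistrib)
    qed (use La Lb Ld LH LR LP le in \<open>meson mult_right_mono norm_ge_zero order_trans\<close>)+
  qed
  moreover have "0 < 8 * L ^ 3" "0 < 1 / (2 * L)" using le(1) by auto
  ultimately show ?thesis unfolding Q_def by blast
qed

text \<open>The residual term does not grow with \<open>k\<close>, because the one-step bound
  contracts. Both estimates of the theorem are read off from this inequality, with
  \<open>r = 0\<close> and with \<open>r\<close> the defect of the exact values.\<close>

lemma mlsdc_iterate_error: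
  fixes f :: "complex^'n \<Rightarrow> complex^'n" and fH :: "complex^'nH \<Rightarrow> complex^'nH"
    and c :: "'m::finite \<Rightarrow> real" and cH :: "'mH::finite \<Rightarrow> real"
  assumes "\<exists>L. L-lipschitz_on UNIV f" "\<exists>L. L-lipschitz_on UNIV fH" "linear R" "linear P"
  shows "\<exists>C \<delta>. 0 < C \<and> 0 < \<delta> \<and> (\<forall>dt t0 u0 V r U k. 0 < dt \<longrightarrow> dt \<le> \<delta> \<longrightarrow>
    V = stack (\<lambda>_. u0) + dt *\<^sub>R (kron_id (colloc_matrix 0 1 c) *v rhs f V) + r \<longrightarrow>
    (\<forall>j. mlsdc_step f fH c cH Qd QdH R P t0 u0 dt (U j) (U (Suc j))) \<longrightarrow>
    norm (V - U k) \<le> (C * dt) ^ k * norm (V - U 0) + C * norm r)"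
proof -
  obtain C \<delta> where C: "0 < C" "0 < \<delta>" and step: "\<And>dt t0 u0 V r U U'. 0 < dt \<Longrightarrow> dt \<le> \<delta> \<Longrightarrow>
    V = stack (\<lambda>_. u0) + dt *\<^sub>R (kron_id (colloc_matrix 0 1 c) *v rhs f V) + r \<Longrightarrow>
    mlsdc_step f fH c cH Qd QdH R P t0 u0 dt U U' \<Longrightarrow>
    norm (V - U') \<le> C * (dt * norm (V - U) + norm r)"
    using mlsdc_step_error[OF assms, of c cH Qd QdH] by metis
  \<comment> \<open>The second bound makes the contraction factor \<open>C * dt\<close> at most
    1/2.\<close>
  define \<delta>' where "\<delta>' = min \<delta> (1 / (2 * C))"
  have "norm (V - U k) \<le> (2 * C * dt) ^ k * norm (V - U 0) + 2 * C * norm r"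
    if dt: "0 < dt" "dt \<le> \<delta>'"
      and V: "V = stack (\<lambda>_. u0) + dt *\<^sub>R (kron_id (colloc_matrix 0 1 c) *v rhs f V) + r"
      and U: "\<forall>j. mlsdc_step f fH c cH Qd QdH R P t0 u0 dt (U j) (U (Suc j))"
    for dt t0 u0 V r U k
  proof -
    have "norm (V - U k) \<le> (C * dt) ^ k * norm (V - U 0) + 2 * (C * norm r)"
    proof (rule perturbed_contraction_iterate)
      show "norm (V - U (Suc k)) \<le> C * dt * norm (V - U k) + C * norm r" for k
        using step[OF dt(1) _ V, of t0 "U k" "U (Suc k)"] U dt
        by (simp add: \<delta>'_def algebra_simps)
      show "C * dt \<le> 1 / 2" using dt C by (simp add: \<delta>'_def field_simps)
    qed (use dt C in auto)
    \<comment> \<open>The residual already carries \<open>2 * C\<close>; enlarging the base as well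
      lets one constant serve both terms.\<close>
    also have "(C * dt) ^ k * norm (V - U 0) \<le> (2 * C * dt) ^ k * norm (V - U 0)"
      using C dt by (intro mult_right_mono power_mono) auto
    finally show ?thesis by simp
  qed
  moreover have "0 < 2 * C" "0 < \<delta>'" using C by (simp_all add: \<delta>'_def)
  ultimately show ?thesis by blast
qed

section \<open>Derivatives relative to subintervals\<close>

lemma cont_diff_on_has_vector_derivative:
  assumes "cont_diff_on p S u" "j < p" "t \<in> S"
  shows "(nth_deriv S j u has_vector_derivative nth_deriv S (Suc j) u t) (at t within S)"
proof -
  have "nth_deriv S j u differentiable (at t within S)"
    using assms by (auto simp: cont_diff_on_def)
  then show ?thesis by (simp add: nth_deriv_def vector_derivative_works)
qed

text \<open>Smoothness is assumed on \<open>{t0..t0 + T}\<close>, while the error bound uses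
  \<open>{t0..t0 + dt}\<close>. Derivatives restrict to a subinterval and, as it is nondegenerate,
  are unique there even at the endpoints; the claim follows by induction on the order.\<close>

lemma nth_deriv_subinterval:
  fixes u :: "real \<Rightarrow> 'a::euclidean_space"
  assumes u: "cont_diff_on p S u" and "a < b" "{a..b} \<subseteq> S" "j \<le> p" "t \<in> {a..b}"
  shows "nth_deriv {a..b} j u t = nth_deriv S j u t"
  using assms(4,5)
proof (induction j arbitrary: t)
  case 0
  then show ?case by (simp add: nth_deriv_def)
next
  case (Suc j)
  have "(nth_deriv S j u has_vector_derivative nth_deriv S (Suc j) u t) (at t within {a..b})"
    using cont_diff_on_has_vector_derivative[OF u, of j t] Suc.prems assms(3)
    by (meson Suc_le_lessD has_vector_derivative_within_subset subsetD)
  then have "(nth_deriv {a..b} j u has_vector_derivative nth_deriv S (Suc j) u t) (at t within {a..b})"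
    using Suc by (auto intro: has_vector_derivative_transform)
  from vector_derivative_within_closed_interval[OF \<open>a < b\<close> Suc.prems(2) this]
  show ?case by (simp add: nth_deriv_def)
qed

lemma cont_diff_on_subinterval:
  fixes u :: "real \<Rightarrow> 'a::euclidean_space"
  assumes u: "cont_diff_on p S u" and ab: "a < b" "{a..b} \<subseteq> S"
  shows "cont_diff_on p {a..b} u"
  unfolding cont_diff_on_def
proof (intro conjI allI impI ballI)
  fix j t assume j: "j < p" and t: "t \<in> {a..b}"
  have "nth_deriv S j u differentiable (at t within {a..b})"
    using u j t ab(2) unfolding cont_diff_on_def
    by (meson differentiable_within_subset subsetD)
  then show "nth_deriv {a..b} j u differentiable (at t within {a..b})"
    using differentiable_transform_within[of "nth_deriv S j u" t "{a..b}" 1 "nth_deriv {a..b} j u"]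
      nth_deriv_subinterval[OF u ab] j t by auto
next
  have "continuous_on {a..b} (nth_deriv S p u)"
    using u ab(2) continuous_on_subset by (auto simp: cont_diff_on_def)
  then show "continuous_on {a..b} (nth_deriv {a..b} p u)"
    by (rule continuous_on_eq) (simp add: nth_deriv_subinterval[OF u ab])
qed

text \<open>A continuous function on a compact interval is bounded, so the supremum is a genuine
  upper bound.\<close>

lemma maxnorm_nth_deriv_le:
  assumes u: "cont_diff_on p {a..b} u" and "t \<in> {a..b}"
  shows "maxnorm (nth_deriv {a..b} p u t) \<le> deriv_norm {a..b} p u"
proof -
  have "continuous_on {a..b} (\<lambda>t. maxnorm (nth_deriv {a..b} p u t))"
    using u by (intro continuous_on_compose2[OF continuous_on_maxnorm[of UNIV]])
      (auto simp: cont_diff_on_def)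
  then have "compact ((\<lambda>t. maxnorm (nth_deriv {a..b} p u t)) ` {a..b})"
    by (rule compact_continuous_image) simp
  then have "bdd_above ((\<lambda>t. maxnorm (nth_deriv {a..b} p u t)) ` {a..b})"
    by (intro bounded_imp_bdd_above compact_imp_bounded)
  then show ?thesis unfolding deriv_norm_def using assms(2) by (intro cSUP_upper)
qed

lemma deriv_norm_nonneg:
  assumes "cont_diff_on p {a..b} u" "a \<le> b"
  shows "0 \<le> deriv_norm {a..b} p u"
  using maxnorm_nth_deriv_le[OF assms(1), of a] maxnorm_nonneg assms(2)
  by (meson atLeastAtMost_iff order_refl order_trans)

lemma deriv_norm_subinterval:
  assumes u: "cont_diff_on p {a..b} u" and "a' < b'" "{a'..b'} \<subseteq> {a..b}"
  shows "deriv_norm {a'..b'} p u \<le> deriv_norm {a..b} p u"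
  unfolding deriv_norm_def[of "{a'..b'}"]
proof (rule cSUP_least)
  fix t assume "t \<in> {a'..b'}"
  then show "maxnorm (nth_deriv {a'..b'} p u t) \<le> deriv_norm {a..b} p u"
    using nth_deriv_subinterval[OF u assms(2,3) order_refl] maxnorm_nth_deriv_le[OF u, of t] assms(3)
    by auto
qed (use assms in auto)

section \<open>Residual of the exact solution\<close>

text \<open>By the differential equation, the residual at a node is the quadrature error for the
  derivative of \<open>u\<close>, so \<open>quadrature_residual_bound\<close> applies node by node.
  The constant depends only on the nodes and the spatial dimension.\<close>

lemma exact_values_residual:
  fixes c :: "'m::{finite,linorder} \<Rightarrow> real"
  assumes "unit_nodes c"
  shows "\<exists>C\<ge>0. \<forall>(f :: complex^'n \<Rightarrow> complex^'n) t0 dt u0 u. 0 < dt \<longrightarrow>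
    ivp_solution f t0 u0 (t0 + dt) u \<longrightarrow> cont_diff_on (CARD('m) + 1) {t0..t0 + dt} u \<longrightarrow>
    norm (exact_values c u t0 dt
      - (stack (\<lambda>_. u0) + dt *\<^sub>R (kron_id (colloc_matrix 0 1 c) *v rhs f (exact_values c u t0 dt))))
    \<le> C * dt ^ (CARD('m) + 1) * deriv_norm {t0..t0 + dt} (CARD('m) + 1) u"
proof -
  let ?M = "CARD('m)"
  define Q where "Q = colloc_matrix 0 1 c"
  define K where "K = real CARD('n)"
  \<comment> \<open>The sum over \<open>m\<close> bounds the norm of the stacked residual by its
    node norms; \<open>K\<close> converts the maximum norm of the derivative into the Euclidean
    norm.\<close>
  define C where "C = (\<Sum>m\<in>UNIV. 1 + (\<Sum>j\<in>UNIV. \<bar>Q $ m $ j\<bar>)) * K"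
  have inj: "inj c" using assms by (simp add: unit_nodes_def strict_mono_on_imp_inj_on)
  have c01: "c j \<in> {0..1}" for j
  proof -
    have "c j \<le> c (Max UNIV)"
      using strict_mono_mono[of c] assms monoD[of c j "Max UNIV"] by (simp add: unit_nodes_def)
    then show ?thesis using assms by (simp add: unit_nodes_def)
  qed
  have "norm (exact_values c u t0 dt
        - (stack (\<lambda>_. u0) + dt *\<^sub>R (kron_id Q *v rhs f (exact_values c u t0 dt))))
      \<le> C * dt ^ (?M + 1) * deriv_norm {t0..t0 + dt} (?M + 1) u"
    if dt: "0 < dt" and ivp: "ivp_solution f t0 u0 (t0 + dt) u"
      and u: "cont_diff_on (?M + 1) {t0..t0 + dt} u"
    for f :: "complex^'n \<Rightarrow> complex^'n" and t0 dt u0 u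
  proof -
    let ?S = "{t0..t0 + dt}"
    define N where "N = deriv_norm ?S (?M + 1) u"
    define D where "D i = nth_deriv ?S i u" for i
    define r where "r m = D 0 (t0 + dt * c m) - D 0 t0
      - dt *\<^sub>R (\<Sum>j\<in>UNIV. Q $ m $ j *\<^sub>R D 1 (t0 + dt * c j))" for m
    have D0: "D 0 = u" by (simp add: D_def nth_deriv_def)
    \<comment> \<open>Uniqueness of the derivative within a nondegenerate interval lets the
      differential equation identify it, endpoints included.\<close>
    have D1: "D 1 t = f (u t)" if "t \<in> ?S" for t
      using vector_derivative_within_closed_interval[of t0 "t0 + dt" t u "f (u t)"] dt ivp that
      by (simp add: D_def nth_deriv_def ivp_solution_def)
    have S: "t0 + dt * c j \<in> ?S" for j
      using c01[of j] dt by (simp add: mult_left_le)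
    have "norm (r m) \<le> (1 + (\<Sum>j\<in>UNIV. \<bar>Q $ m $ j\<bar>)) * (K * N) * dt ^ (?M + 1)" for m
      unfolding r_def Q_def
    proof (rule quadrature_residual_bound[OF inj c01 dt])
      show "(D i has_vector_derivative D (Suc i) t) (at t within ?S)" if "i \<le> ?M" "t \<in> ?S" for i t
        unfolding D_def using that by (intro cont_diff_on_has_vector_derivative[OF u]) auto
      show "norm (D (Suc ?M) t) \<le> K * N" if "t \<in> ?S" for t
        unfolding K_def N_def
        using norm_le_maxnorm[of "D (Suc ?M) t"] maxnorm_nth_deriv_le[OF u that]
        by (simp add: D_def) (meson mult_left_mono of_nat_0_le_iff order_trans)
    qed
    then have "(\<Sum>m\<in>UNIV. norm (r m)) \<le> (\<Sum>m\<in>UNIV. (1 + (\<Sum>j\<in>UNIV. \<bar>Q $ m $ j\<bar>)) * (K * N) * dt ^ (?M + 1))"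
      by (intro sum_mono)
    also have "\<dots> = C * dt ^ (?M + 1) * N"
      unfolding C_def by (simp only: sum_distrib_right[symmetric]) (simp only: mult_ac)
    finally have "norm (stack r) \<le> C * dt ^ (?M + 1) * N"
      unfolding norm_stack using L2_set_le_sum[of UNIV "\<lambda>m. norm (r m)"] by simp
    moreover have "stack r = exact_values c u t0 dt
        - (stack (\<lambda>_. u0) + dt *\<^sub>R (kron_id Q *v rhs f (exact_values c u t0 dt)))"
    proof -
      have "rhs f (exact_values c u t0 dt) = stack (\<lambda>m. D 1 (t0 + dt * c m))"
        by (simp add: rhs_def exact_values_def stack_def node_value_def scaled_nodes_def
            vec_lambda_eta D1[OF S] del: One_nat_def)
      moreover have "u t0 = u0" using ivp by (simp add: ivp_solution_def)
      ultimately show ?thesis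
        by (simp add: kron_id_stack del: One_nat_def)
          (simp add: r_def D0 exact_values_def stack_def scaled_nodes_def vec_eq_iff)
    qed
    ultimately show ?thesis by (simp add: N_def)
  qed
  moreover have "0 \<le> C" by (auto simp: C_def K_def intro!: sum_nonneg mult_nonneg_nonneg add_nonneg_nonneg)
  ultimately show ?thesis unfolding Q_def by blast
qed

section \<open>The linear rate and the order estimate\<close>

text \<open>The bound for one iteration gives the rate, and the bound for \<open>k\<close>
  iterations gives the convergence.\<close>

lemma mlsdc_rate:
  fixes f :: "complex^'n \<Rightarrow> complex^'n" and fH :: "complex^'nH \<Rightarrow> complex^'nH"
    and c :: "'m::finite \<Rightarrow> real" and cH :: "'mH::finite \<Rightarrow> real"
  assumes "\<exists>L. L-lipschitz_on UNIV f" "\<exists>L. L-lipschitz_on UNIV fH" "linear R" "linear P"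
  shows "\<exists>C9 \<delta>. 0 < \<delta> \<and> C9 * \<delta> < 1 \<and>
    (\<forall>dt\<in>{0<..\<delta>}. \<forall>t0 u0 Uh U.
      colloc_solution f c t0 u0 dt Uh \<longrightarrow>
      (\<forall>k. mlsdc_step f fH c cH Qd QdH R P t0 u0 dt (U k) (U (Suc k))) \<longrightarrow>
      (\<forall>k\<ge>1. maxnorm (Uh - U k) \<le> C9 * dt * maxnorm (Uh - U (k - 1))) \<and> U \<longlonglongrightarrow> Uh)"
proof -
  obtain C \<delta> where C: "0 < C" "0 < \<delta>" and err: "\<And>dt t0 u0 V r U k. 0 < dt \<Longrightarrow> dt \<le> \<delta> \<Longrightarrow>
    V = stack (\<lambda>_. u0) + dt *\<^sub>R (kron_id (colloc_matrix 0 1 c) *v rhs f V) + r \<Longrightarrow>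
    (\<forall>j. mlsdc_step f fH c cH Qd QdH R P t0 u0 dt (U j) (U (Suc j))) \<Longrightarrow>
    norm (V - U k) \<le> (C * dt) ^ k * norm (V - U 0) + C * norm r"
    using mlsdc_iterate_error[OF assms, of c cH Qd QdH] by metis
  define \<kappa> where "\<kappa> = real CARD('m \<times> 'n)"
  have \<kappa>: "1 \<le> \<kappa>" by (simp add: \<kappa>_def Suc_le_eq del: card_prod)
  \<comment> \<open>This keeps \<open>C * \<kappa> * \<delta>'\<close> at most 1/2, so that the rate
    is a contraction also in the maximum norm.\<close>
  define \<delta>' where "\<delta>' = min \<delta> (1 / (2 * (C * \<kappa>)))"
  have \<delta>': "0 < \<delta>'" using C \<kappa> by (simp add: \<delta>'_def)
  have "C * \<kappa> * \<delta>' \<le> C * \<kappa> * (1 / (2 * (C * \<kappa>)))"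
    unfolding \<delta>'_def using C \<kappa> by (intro mult_left_mono) auto
  also have "\<dots> = 1 / 2" using C \<kappa> by simp
  finally have half: "C * \<kappa> * \<delta>' \<le> 1 / 2" .
  have "(\<forall>k\<ge>1. maxnorm (Uh - U k) \<le> C * \<kappa> * dt * maxnorm (Uh - U (k - 1))) \<and> U \<longlonglongrightarrow> Uh"
    if dt: "dt \<in> {0<..\<delta>'}" and Uh: "colloc_solution f c t0 u0 dt Uh"
      and U: "\<forall>k. mlsdc_step f fH c cH Qd QdH R P t0 u0 dt (U k) (U (Suc k))" for dt t0 u0 Uh U
  proof
    have "Uh - dt *\<^sub>R (kron_id (colloc_matrix 0 1 c) *v rhs f Uh) = stack (\<lambda>_. u0)"
      using Uh dt unfolding colloc_solution_def colloc_op_def by (simp add: colloc_matrix_scale[of dt t0])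
    then have V: "Uh = stack (\<lambda>_. u0) + dt *\<^sub>R (kron_id (colloc_matrix 0 1 c) *v rhs f Uh) + 0"
      by (simp only: diff_eq_eq add_0_right)
    have dt': "0 < dt" "dt \<le> \<delta>" using dt by (auto simp: \<delta>'_def)
    show "\<forall>k\<ge>1. maxnorm (Uh - U k) \<le> C * \<kappa> * dt * maxnorm (Uh - U (k - 1))"
    proof (intro allI impI)
      fix k :: nat assume "1 \<le> k"
      then obtain i where k: "k = Suc i" by (cases k) auto
      have "maxnorm (Uh - U k) \<le> norm (Uh - U k)" by (rule maxnorm_le_norm)
      \<comment> \<open>One iteration of the sequence restarted at index \<open>i\<close>.\<close>
      also have "\<dots> \<le> C * dt * norm (Uh - U i)"
        using err[OF dt' V, of t0 "\<lambda>j. U (i + j)" 1] U by (simp add: k)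
      also have "\<dots> \<le> C * dt * (\<kappa> * maxnorm (Uh - U i))"
        using C dt' norm_le_maxnorm[of "Uh - U i"] unfolding \<kappa>_def by (intro mult_left_mono) auto
      finally show "maxnorm (Uh - U k) \<le> C * \<kappa> * dt * maxnorm (Uh - U (k - 1))"
        by (simp add: k mult_ac)
    qed
    \<comment> \<open>Convergence is shown in the Euclidean norm, where the factor is
      \<open>C * dt\<close>; it is small enough because \<open>1 \<le> \<kappa>\<close>.\<close>
    have "C * dt \<le> C * \<kappa> * \<delta>'" using dt C \<kappa> by (intro mult_mono) auto
    then have "C * dt < 1" using half by linarith
    then have "(\<lambda>k. (C * dt) ^ k * norm (Uh - U 0)) \<longlonglongrightarrow> 0"
      using dt' C by (intro tendsto_mult_left_zero LIMSEQ_realpow_zero) auto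
    then have "(\<lambda>k. Uh - U k) \<longlonglongrightarrow> 0"
      by (rule Lim_null_comparison[rotated]) (use err[OF dt' V U] in simp)
    then show "U \<longlonglongrightarrow> Uh"
      using tendsto_diff[OF tendsto_const[of Uh], of "\<lambda>k. Uh - U k" 0 sequentially] by simp
  qed
  then show ?thesis using \<delta>' half
    by - (rule exI[of _ "C * \<kappa>"], rule exI[of _ \<delta>'], simp)
qed

text \<open>Each iteration multiplies the initial error of order \<open>k0\<close> by a factor
  proportional to \<open>dt\<close>, giving \<open>k0 + k\<close>; the defect of the exact values
  adds the term of order \<open>CARD('m) + 1\<close>.\<close>

lemma mlsdc_order:
  fixes f :: "complex^'n \<Rightarrow> complex^'n" and fH :: "complex^'nH \<Rightarrow> complex^'nH"
    and c :: "'m::{finite,linorder} \<Rightarrow> real" and cH :: "'mH::finite \<Rightarrow> real"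
  assumes "\<exists>L. L-lipschitz_on UNIV f" "\<exists>L. L-lipschitz_on UNIV fH" "linear R" "linear P"
    and c: "unit_nodes c"
  shows "\<exists>C10 C11 \<delta>. 0 \<le> C10 \<and> 0 \<le> C11 \<and> 0 < \<delta> \<and>
    (\<forall>t0 u0 T u U. 0 < T \<longrightarrow>
      ivp_solution f t0 u0 (t0 + T) u \<longrightarrow>
      cont_diff_on (CARD('m) + 1) {t0..t0 + T} u \<longrightarrow>
      cont_diff_on (k0 + 1) {t0..t0 + T} u \<longrightarrow>
      (\<forall>dt\<in>{0<..T}. \<forall>j.
         mlsdc_step f fH c cH Qd QdH R P t0 u0 dt (U dt j) (U dt (Suc j))) \<longrightarrow>
      approx_order c u t0 T k0 K (\<lambda>dt. U dt 0) \<longrightarrow>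
      (\<forall>dt\<in>{0<..min \<delta> T}.
         maxnorm (exact_values c u t0 dt - U dt k)
           \<le> C10 * dt ^ (k0 + k) * deriv_norm {t0..t0 + dt} (k0 + 1) u
             + C11 * dt ^ (CARD('m) + 1) * deriv_norm {t0..t0 + dt} (CARD('m) + 1) u))"
proof -
  let ?M = "CARD('m)"
  obtain C \<delta> where C: "0 < C" "0 < \<delta>" and err: "\<And>dt t0 u0 V r U k. 0 < dt \<Longrightarrow> dt \<le> \<delta> \<Longrightarrow>
    V = stack (\<lambda>_. u0) + dt *\<^sub>R (kron_id (colloc_matrix 0 1 c) *v rhs f V) + r \<Longrightarrow>
    (\<forall>j. mlsdc_step f fH c cH Qd QdH R P t0 u0 dt (U j) (U (Suc j))) \<Longrightarrow>
    norm (V - U k) \<le> (C * dt) ^ k * norm (V - U 0) + C * norm r"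
    using mlsdc_iterate_error[OF assms(1-4), of c cH Qd QdH] by metis
  obtain Cr where Cr: "0 \<le> Cr" and res: "\<And>t0 dt u0 u. 0 < dt \<Longrightarrow> ivp_solution f t0 u0 (t0 + dt) u \<Longrightarrow>
    cont_diff_on (?M + 1) {t0..t0 + dt} u \<Longrightarrow>
    norm (exact_values c u t0 dt
      - (stack (\<lambda>_. u0) + dt *\<^sub>R (kron_id (colloc_matrix 0 1 c) *v rhs f (exact_values c u t0 dt))))
    \<le> Cr * dt ^ (?M + 1) * deriv_norm {t0..t0 + dt} (?M + 1) u"
    using exact_values_residual[OF c, where ?'n = 'n] by metis
  define \<kappa> where "\<kappa> = real CARD('m \<times> 'n)"
  have \<kappa>: "0 \<le> \<kappa>" by (simp add: \<kappa>_def)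
  \<comment> \<open>\<open>K\<close> is an arbitrary real; its absolute value keeps
    \<open>C10\<close> nonnegative, as the order statement requires.\<close>
  define C10 where "C10 = C ^ k * (\<kappa> * \<bar>K\<bar>)"
  define C11 where "C11 = C * Cr"
  have "maxnorm (exact_values c u t0 dt - U dt k)
      \<le> C10 * dt ^ (k0 + k) * deriv_norm {t0..t0 + dt} (k0 + 1) u
        + C11 * dt ^ (?M + 1) * deriv_norm {t0..t0 + dt} (?M + 1) u"
    if T: "0 < T" and ivp: "ivp_solution f t0 u0 (t0 + T) u"
      and u: "cont_diff_on (?M + 1) {t0..t0 + T} u" "cont_diff_on (k0 + 1) {t0..t0 + T} u"
      and U: "\<forall>dt\<in>{0<..T}. \<forall>j. mlsdc_step f fH c cH Qd QdH R P t0 u0 dt (U dt j) (U dt (Suc j))"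
      and init: "approx_order c u t0 T k0 K (\<lambda>dt. U dt 0)"
      and dt: "dt \<in> {0<..min \<delta> T}"
    for t0 u0 T u U dt
  proof -
    let ?V = "exact_values c u t0 dt" and ?S = "{t0..t0 + dt}"
    have dt': "0 < dt" "dt \<le> \<delta>" "dt \<in> {0<..T}" and sub: "t0 < t0 + dt" "?S \<subseteq> {t0..t0 + T}"
      using dt by auto
    define r where "r = ?V - (stack (\<lambda>_. u0) + dt *\<^sub>R (kron_id (colloc_matrix 0 1 c) *v rhs f ?V))"
    have V: "?V = stack (\<lambda>_. u0) + dt *\<^sub>R (kron_id (colloc_matrix 0 1 c) *v rhs f ?V) + r"
      by (simp add: r_def)
    have ivp': "ivp_solution f t0 u0 (t0 + dt) u"
      using ivp sub unfolding ivp_solution_def by (meson has_vector_derivative_within_subset subsetD)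
    have r: "norm r \<le> Cr * dt ^ (?M + 1) * deriv_norm ?S (?M + 1) u"
      unfolding r_def by (intro res dt' ivp' cont_diff_on_subinterval[OF u(1) sub])
    define N where "N = deriv_norm ?S (k0 + 1) u"
    have N: "0 \<le> N"
      unfolding N_def using dt' by (intro deriv_norm_nonneg cont_diff_on_subinterval[OF u(2) sub]) auto
    have "norm (?V - U dt 0) \<le> \<kappa> * maxnorm (?V - U dt 0)"
      unfolding \<kappa>_def by (rule norm_le_maxnorm)
    also have "maxnorm (?V - U dt 0) \<le> K * dt ^ k0 * N"
      using init dt' by (simp add: approx_order_def N_def)
    also have "\<dots> \<le> \<bar>K\<bar> * dt ^ k0 * N"
      using N dt' by (intro mult_right_mono) auto
    finally have V0: "norm (?V - U dt 0) \<le> \<kappa> * (\<bar>K\<bar> * dt ^ k0 * N)"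
      using \<kappa> by (simp add: mult_left_mono)
    have "maxnorm (?V - U dt k) \<le> norm (?V - U dt k)" by (rule maxnorm_le_norm)
    also have "\<dots> \<le> (C * dt) ^ k * norm (?V - U dt 0) + C * norm r"
      using err[OF dt'(1,2) V, of t0 "U dt" k] U dt' by blast
    also have "\<dots> \<le> (C * dt) ^ k * (\<kappa> * (\<bar>K\<bar> * dt ^ k0 * N))
        + C * (Cr * dt ^ (?M + 1) * deriv_norm ?S (?M + 1) u)"
      using V0 r C dt' by (intro add_mono mult_left_mono) auto
    also have "\<dots> = C10 * dt ^ (k0 + k) * N + C11 * dt ^ (?M + 1) * deriv_norm ?S (?M + 1) u"
      by (simp add: C10_def C11_def power_mult_distrib power_add mult_ac)
    finally show ?thesis by (simp add: N_def)
  qed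
  moreover have "0 \<le> C10" "0 \<le> C11" using C Cr \<kappa> by (simp_all add: C10_def C11_def)
  ultimately show ?thesis using C(2) by blast
qed

section \<open>From explicit bounds to the order of convergence\<close>

lemma mult_power_le_power_min:
  fixes x :: real
  assumes "0 < x" "x \<le> 1" "0 \<le> A" "a \<le> A'" "0 \<le> A'" "n \<le> m"
  shows "A * x ^ m * a \<le> A * A' * x ^ n"
proof -
  have "x ^ m * a \<le> x ^ m * A'" using assms by (intro mult_left_mono) auto
  also have "\<dots> \<le> x ^ n * A'"
    using assms by (intro mult_right_mono power_decreasing) auto
  finally have "x ^ m * a \<le> x ^ n * A'" .
  from mult_left_mono[OF this assms(3)] show ?thesis by (simp add: mult_ac)
qed

text \<open>For \<open>x\<close> at most 1 the smaller power dominates both terms, and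
  \<open>a\<close> and \<open>b\<close> are replaced by constant bounds, which leaves a single
  constant.\<close>

lemma bigo_of_two_power_bound:
  fixes e :: "real \<Rightarrow> real"
  assumes "0 < \<delta>" "0 \<le> A" "0 \<le> B" "0 \<le> A'" "0 \<le> B'"
    and e: "\<And>x. x \<in> {0<..\<delta>} \<Longrightarrow> 0 \<le> e x \<and> e x \<le> A * x ^ m * a x + B * x ^ n * b x"
    and ab: "\<And>x. x \<in> {0<..\<delta>} \<Longrightarrow> a x \<le> A' \<and> b x \<le> B'"
  shows "e \<in> O[at_right 0](\<lambda>x. x ^ min m n)"
proof (rule bigoI)
  have "norm (e x) \<le> (A * A' + B * B') * norm (x ^ min m n)" if "0 < x" "x < min \<delta> 1" for x
  proof -
    have x: "x \<in> {0<..\<delta>}" "x \<le> 1" using that by auto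
    have "e x \<le> A * x ^ m * a x + B * x ^ n * b x" using e x by blast
    also have "\<dots> \<le> A * A' * x ^ min m n + B * B' * x ^ min m n"
      using assms x ab[OF x(1)] by (intro add_mono mult_power_le_power_min) auto
    finally show ?thesis using e[OF x(1)] that by (simp add: algebra_simps)
  qed
  then show "\<forall>\<^sub>F x in at_right 0. norm (e x) \<le> (A * A' + B * B') * norm (x ^ min m n)"
    using assms(1) by (auto simp: eventually_at_right_field intro!: exI[of _ "min \<delta> 1"])
qed

theorem theorem3p1:
  fixes f :: "complex^'n \<Rightarrow> complex^'n"
    and fH :: "complex^'nH \<Rightarrow> complex^'nH"
    and c :: "'m::{finite,linorder} \<Rightarrow> real"
    and cH :: "'mH::{finite,linorder} \<Rightarrow> real"
    and Qd :: "real^('m::{finite,linorder})^('m::{finite,linorder})"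
    and QdH :: "real^('mH::{finite,linorder})^('mH::{finite,linorder})"
    and R :: "complex^('m \<times> 'n) \<Rightarrow> complex^('mH \<times> 'nH)"
    and P :: "complex^('mH \<times> 'nH) \<Rightarrow> complex^('m \<times> 'n)"
  assumes "\<exists>L. L-lipschitz_on UNIV f"
    and "\<exists>L. L-lipschitz_on UNIV fH"
    and "unit_nodes c"
    and "unit_nodes cH"
    and "lower_triangular Qd"
    and "lower_triangular QdH"
    and "Vector_Spaces.linear (*s) (*s) R"
    and "Vector_Spaces.linear (*s) (*s) P"
  shows "(\<exists>C9 \<delta>. 0 < \<delta> \<and> C9 * \<delta> < 1 \<and>
           (\<forall>dt\<in>{0<..\<delta>}. \<forall>t0 u0 Uh U.
              colloc_solution f c t0 u0 dt Uh \<longrightarrow>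
              (\<forall>k. mlsdc_step f fH c cH Qd QdH R P t0 u0 dt (U k) (U (Suc k))) \<longrightarrow>
              (\<forall>k\<ge>1. maxnorm (Uh - U k) \<le> C9 * dt * maxnorm (Uh - U (k - 1))) \<and>
              U \<longlonglongrightarrow> Uh))
       \<and> (\<forall>k0 k K. 1 \<le> k \<longrightarrow>
           (\<exists>C10 C11 \<delta>. 0 < \<delta> \<and>
             (\<forall>t0 u0 T u U. 0 < T \<longrightarrow>
                ivp_solution f t0 u0 (t0 + T) u \<longrightarrow>
                cont_diff_on (CARD('m) + 1) {t0..t0 + T} u \<longrightarrow>
                cont_diff_on (k0 + 1) {t0..t0 + T} u \<longrightarrow>
                (\<forall>dt\<in>{0<..T}. \<forall>j.
                   mlsdc_step f fH c cH Qd QdH R P t0 u0 dt (U dt j) (U dt (Suc j))) \<longrightarrow>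
                approx_order c u t0 T k0 K (\<lambda>dt. U dt 0) \<longrightarrow>
                (\<forall>dt\<in>{0<..min \<delta> T}.
                   maxnorm (exact_values c u t0 dt - U dt k)
                     \<le> C10 * dt ^ (k0 + k) * deriv_norm {t0..t0 + dt} (k0 + 1) u
                       + C11 * dt ^ (CARD('m) + 1) * deriv_norm {t0..t0 + dt} (CARD('m) + 1) u) \<and>
                (\<lambda>dt. maxnorm (exact_values c u t0 dt - U dt k))
                  \<in> O[at_right 0](\<lambda>dt. dt ^ min (k0 + k) (CARD('m) + 1)))))"
proof (intro conjI allI impI)
  note lin = assms(7,8)[THEN complex_linear_imp_linear]
  show "\<exists>C9 \<delta>. 0 < \<delta> \<and> C9 * \<delta> < 1 \<and>
      (\<forall>dt\<in>{0<..\<delta>}. \<forall>t0 u0 Uh U.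
        colloc_solution f c t0 u0 dt Uh \<longrightarrow>
        (\<forall>k. mlsdc_step f fH c cH Qd QdH R P t0 u0 dt (U k) (U (Suc k))) \<longrightarrow>
        (\<forall>k\<ge>1. maxnorm (Uh - U k) \<le> C9 * dt * maxnorm (Uh - U (k - 1))) \<and> U \<longlonglongrightarrow> Uh)"
    by (rule mlsdc_rate[OF assms(1,2) lin])
  fix k0 k :: nat and K :: real
  obtain C10 C11 \<delta> where C: "0 \<le> C10" "0 \<le> C11" "0 < \<delta>" and bound: "\<And>t0 u0 T u U dt. 0 < T \<Longrightarrow>
      ivp_solution f t0 u0 (t0 + T) u \<Longrightarrow>
      cont_diff_on (CARD('m) + 1) {t0..t0 + T} u \<Longrightarrow>
      cont_diff_on (k0 + 1) {t0..t0 + T} u \<Longrightarrow>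
      (\<forall>dt\<in>{0<..T}. \<forall>j.
         mlsdc_step f fH c cH Qd QdH R P t0 u0 dt (U dt j) (U dt (Suc j))) \<Longrightarrow>
      approx_order c u t0 T k0 K (\<lambda>dt. U dt 0) \<Longrightarrow>
      dt \<in> {0<..min \<delta> T} \<Longrightarrow>
      maxnorm (exact_values c u t0 dt - U dt k)
        \<le> C10 * dt ^ (k0 + k) * deriv_norm {t0..t0 + dt} (k0 + 1) u
          + C11 * dt ^ (CARD('m) + 1) * deriv_norm {t0..t0 + dt} (CARD('m) + 1) u"
    using mlsdc_order[OF assms(1,2) lin assms(3), of k0 cH Qd QdH K k] by metis
  show "\<exists>C10 C11 \<delta>. 0 < \<delta> \<and>
      (\<forall>t0 u0 T u U. 0 < T \<longrightarrow>
        ivp_solution f t0 u0 (t0 + T) u \<longrightarrow>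
        cont_diff_on (CARD('m) + 1) {t0..t0 + T} u \<longrightarrow>
        cont_diff_on (k0 + 1) {t0..t0 + T} u \<longrightarrow>
        (\<forall>dt\<in>{0<..T}. \<forall>j.
           mlsdc_step f fH c cH Qd QdH R P t0 u0 dt (U dt j) (U dt (Suc j))) \<longrightarrow>
        approx_order c u t0 T k0 K (\<lambda>dt. U dt 0) \<longrightarrow>
        (\<forall>dt\<in>{0<..min \<delta> T}.
           maxnorm (exact_values c u t0 dt - U dt k)
             \<le> C10 * dt ^ (k0 + k) * deriv_norm {t0..t0 + dt} (k0 + 1) u
               + C11 * dt ^ (CARD('m) + 1) * deriv_norm {t0..t0 + dt} (CARD('m) + 1) u) \<and>
        (\<lambda>dt. maxnorm (exact_values c u t0 dt - U dt k))
          \<in> O[at_right 0](\<lambda>dt. dt ^ min (k0 + k) (CARD('m) + 1)))"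
  proof (rule exI[of _ C10], rule exI[of _ C11], rule exI[of _ \<delta>], intro conjI allI impI ballI)
    fix t0 u0 T u U
    assume T: "0 < T" and u: "cont_diff_on (CARD('m) + 1) {t0..t0 + T} u" "cont_diff_on (k0 + 1) {t0..t0 + T} u"
      and rest: "ivp_solution f t0 u0 (t0 + T) u"
        "\<forall>dt\<in>{0<..T}. \<forall>j. mlsdc_step f fH c cH Qd QdH R P t0 u0 dt (U dt j) (U dt (Suc j))"
        "approx_order c u t0 T k0 K (\<lambda>dt. U dt 0)"
    note b = bound[OF T rest(1) u rest(2,3)]
    show "maxnorm (exact_values c u t0 dt - U dt k)
        \<le> C10 * dt ^ (k0 + k) * deriv_norm {t0..t0 + dt} (k0 + 1) u
          + C11 * dt ^ (CARD('m) + 1) * deriv_norm {t0..t0 + dt} (CARD('m) + 1) u"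
      if "dt \<in> {0<..min \<delta> T}" for dt
      using that by (rule b)
    show "(\<lambda>dt. maxnorm (exact_values c u t0 dt - U dt k))
        \<in> O[at_right 0](\<lambda>dt. dt ^ min (k0 + k) (CARD('m) + 1))"
    proof (rule bigo_of_two_power_bound[where \<delta> = "min \<delta> T"])
      fix dt assume dt: "dt \<in> {0<..min \<delta> T}"
      show "0 \<le> maxnorm (exact_values c u t0 dt - U dt k) \<and>
          maxnorm (exact_values c u t0 dt - U dt k)
            \<le> C10 * dt ^ (k0 + k) * deriv_norm {t0..t0 + dt} (k0 + 1) u
              + C11 * dt ^ (CARD('m) + 1) * deriv_norm {t0..t0 + dt} (CARD('m) + 1) u"
        using maxnorm_nonneg b[OF dt] by blast
      \<comment> \<open>The norms over the shrinking interval are dominated by those over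
        \<open>{t0..t0 + T}\<close>, which do not depend on \<open>dt\<close>.\<close>
      show "deriv_norm {t0..t0 + dt} (k0 + 1) u \<le> deriv_norm {t0..t0 + T} (k0 + 1) u \<and>
          deriv_norm {t0..t0 + dt} (CARD('m) + 1) u \<le> deriv_norm {t0..t0 + T} (CARD('m) + 1) u"
        using dt by (intro conjI deriv_norm_subinterval u) auto
    qed (use T C u in \<open>auto intro: deriv_norm_nonneg simp del: One_nat_def add_Suc_right Suc_eq_plus1\<close>)
  qed (rule C(3))
qed

end
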